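(* There exist infinitely many pairs $(G,G')$ of cospectral cubic graphs such that $G$ and $G'$ have different chromatic index.
   Context: Graphs are finite, undirected and simple (no loops or multiple edges). A cubic graph is a graph that is regular of degree $3$. The spectrum of a graph is the multiset of eigenvalues of its adjacency matrix (with multiplicities), and two graphs are cospectral if they have the same spectrum. The chromatic index (edge-chromatic number) of a graph is the minimum number of colours in a colouring of its edges in which any two distinct edges sharing a vertex receive different colours. Pairs of graphs are counted up to isomorphism. *)

theory Defs
  imports
    "Graph_Theory.Pair_Digraph"
    "Graph_Theory.Digraph_Isomorphism"
    "Jordan_Normal_Form.Char_Poly"
    "HOL-Computational_Algebra.Polynomial"
    "HOL-Library.Multiset"
    Complex_Main
begin

text \<open>
  A finite simple graph is a \<^locale>\<open>pair_graph\<close>: a finite vertex set together with a finite,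
  symmetric and irreflexive set of arcs. An undirected edge \<open>{u, v}\<close> corresponds to
  the two arcs \<open>(u, v)\<close> and \<open>(v, u)\<close>.
\<close>

definition edges :: "'a pair_pre_digraph \<Rightarrow> 'a set set" where
  "edges G = {{u, v} | u v. (u, v) \<in> parcs G}"

text \<open>By symmetry of the arcs, the out-degree is the number of neighbours.\<close>

definition cubic_graph :: "'a pair_pre_digraph \<Rightarrow> bool" where
  "cubic_graph G \<longleftrightarrow> pair_graph G \<and> (\<forall>v \<in> pverts G. out_degree (with_proj G) v = 3)"

text \<open>
  Rows and columns follow the increasing enumeration of the vertices; another enumeration would
  conjugate the matrix by a permutation matrix, which does not affect the spectrum.
\<close>

definition adjacency_matrix :: "'a::linorder pair_pre_digraph \<Rightarrow> complex mat" where
  "adjacency_matrix G =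
     (let vs = sorted_list_of_set (pverts G); n = card (pverts G)
      in mat n n (\<lambda>(i, j). if (vs ! i, vs ! j) \<in> parcs G then 1 else 0))"

text \<open>
  \<^const>\<open>proots\<close> counts each root with its order, so every eigenvalue occurs with its
  algebraic multiplicity. As the matrix is real and symmetric, this is also
  the geometric multiplicity, and all eigenvalues are real.
\<close>

definition graph_spectrum :: "'a::linorder pair_pre_digraph \<Rightarrow> complex multiset" where
  "graph_spectrum G = proots (char_poly (adjacency_matrix G))"

definition cospectral :: "'a::linorder pair_pre_digraph \<Rightarrow> 'b::linorder pair_pre_digraph \<Rightarrow> bool" where
  "cospectral G H \<longleftrightarrow> graph_spectrum G = graph_spectrum H"

definition proper_edge_colouring :: "'a pair_pre_digraph \<Rightarrow> ('a set \<Rightarrow> 'c) \<Rightarrow> bool" where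
  "proper_edge_colouring G c \<longleftrightarrow>
     (\<forall>e \<in> edges G. \<forall>f \<in> edges G. e \<noteq> f \<and> e \<inter> f \<noteq> {} \<longrightarrow> c e \<noteq> c f)"

definition chromatic_index :: "'a pair_pre_digraph \<Rightarrow> nat" where
  "chromatic_index G =
     (LEAST k. \<exists>c :: 'a set \<Rightarrow> nat. c ` edges G \<subseteq> {..<k} \<and> proper_edge_colouring G c)"

lemma chromatic_index_attained:
  assumes "pair_graph G"
  shows "\<exists>c :: 'a set \<Rightarrow> nat.
           c ` edges (G :: 'a pair_pre_digraph) \<subseteq> {..<chromatic_index G} \<and> proper_edge_colouring G c"
proof -
  interpret pair_graph G by fact
  have "edges G = (\<lambda>(u, v). {u, v}) ` parcs G"
    by (auto simp: edges_def)
  then have "finite (edges G)"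
    using pair_finite_arcs by simp
  then obtain c :: "'a set \<Rightarrow> nat" and n where c: "c ` edges G = {i. i < n}" "inj_on c (edges G)"
    using finite_imp_inj_to_nat_seg[of "edges G"] by metis
  have "c ` edges G \<subseteq> {..<n}"
    unfolding c(1) lessThan_def ..
  moreover have "proper_edge_colouring G c"
    unfolding proper_edge_colouring_def using inj_on_contraD[OF c(2)] by metis
  ultimately have "\<exists>k. \<exists>c :: 'a set \<Rightarrow> nat. c ` edges G \<subseteq> {..<k} \<and> proper_edge_colouring G c"
    by (intro exI conjI)
  then show ?thesis
    unfolding chromatic_index_def by (rule LeastI_ex)
qed

definition pair_iso :: "(('a pair_pre_digraph \<times> 'b pair_pre_digraph) \<times>
                         ('a pair_pre_digraph \<times> 'b pair_pre_digraph)) set" where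
  "pair_iso = {((G, G'), (H, H')).
     digraph_iso (with_proj G) (with_proj H) \<and> digraph_iso (with_proj G') (with_proj H')}"

text \<open>
  \<^const>\<open>digraph_iso\<close> presupposes well-formedness only, hence the explicit restriction.
\<close>

lemma equiv_pair_iso:
  fixes A :: "('a pair_pre_digraph \<times> 'b pair_pre_digraph) set"
  assumes "A = {(G, G'). pair_graph G \<and> pair_graph G'}"
  shows "equiv A (pair_iso \<inter> A \<times> A)"
proof -
  have wf: "wf_digraph (with_proj G)" if "pair_graph G" for G :: "'c pair_pre_digraph"
    using that by (simp add: wf_digraph_wp_iff pair_graph_def pair_digraph_def pair_fin_digraph_def)
  have r: "digraph_iso (with_proj G) (with_proj G)" if "pair_graph G" for G :: "'c pair_pre_digraph"
  proof -
    let ?f = "\<lparr>iso_verts = id, iso_arcs = id, iso_head = snd, iso_tail = fst\<rparr>"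
    have "pre_digraph.digraph_isomorphism (with_proj G) ?f"
      using wf[OF that] by (simp add: pre_digraph.digraph_isomorphism_def)
    moreover have "with_proj G = app_iso ?f (with_proj G)"
      by (simp add: app_iso_def with_proj_def)
    ultimately show ?thesis
      unfolding digraph_iso_def by blast
  qed
  show ?thesis
  proof (rule equivI)
    show "pair_iso \<inter> A \<times> A \<subseteq> A \<times> A"
      by (rule Int_lower2)
    show "refl_on A (pair_iso \<inter> A \<times> A)"
      unfolding refl_on_def pair_iso_def assms by (blast intro: r)
    show "sym (pair_iso \<inter> A \<times> A)"
      unfolding sym_on_def pair_iso_def assms by (blast intro: digraph_iso_swap wf)
    show "trans (pair_iso \<inter> A \<times> A)"
      unfolding trans_on_def pair_iso_def assms by clarsimp (metis digraph_iso_trans)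
  qed
qed

end

theory Submission
  imports Defs
begin

text \<open>
  Graphs need not be connected, so one pair of cospectral cubic graphs \<open>G\<close>, \<open>G'\<close> of which only \<open>G\<close>
  has a proper edge colouring with three colours already yields infinitely many: add \<open>k\<close> disjoint
  copies of \<open>K\<^sub>4\<close> to both graphs. The characteristic polynomial is multiplicative over disjoint sums
  (\<open>char_poly_disjoint_sum\<close>), so the sums stay cospectral; \<open>K\<^sub>4\<close> is cubic and 3-edge-colourable, so a
  sum is 3-edge-colourable if and only if the graph that one started from is
  (\<open>edge_colourable_add_K4s_iff\<close>); and different \<open>k\<close> give different numbers of vertices, hence
  non-isomorphic pairs.

  The pair to start from has 16 vertices. The graph \<open>G'\<close> is the Petersen graph with the three vertices
  of a path replaced by triangles. The three edges that leave a triangle have distinct colours in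
  every 3-edge-colouring, so a colouring of \<open>G'\<close> would give one of the Petersen graph, which has none.
  The graph \<open>G\<close> is a Hamiltonian cycle together with a perfect matching; the cycle is even, hence a
  union of two perfect matchings, and the three matchings are the colours.

  Two facts about the pair rest on finite computation. That \<open>G'\<close> is not 3-edge-colourable is shown by
  exhaustive search on \<open>G'\<close> itself (\<open>extensible_if_proper\<close>). Cospectrality is certified by an
  invertible integer matrix \<open>P\<close> with \<open>A P = P B\<close>, where \<open>A\<close> and \<open>B\<close> are the adjacency matrices: it makes
  \<open>A\<close> and \<open>B\<close> similar (\<open>char_poly_eq_if_intertwined\<close>).
\<close>

section \<open>Chromatic index as colourability\<close>

definition edge_colourable :: "nat \<Rightarrow> 'a pair_pre_digraph \<Rightarrow> bool" where
  "edge_colourable k G \<longleftrightarrow>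
     (\<exists>c :: 'a set \<Rightarrow> nat. c ` edges G \<subseteq> {..<k} \<and> proper_edge_colouring G c)"

lemma edge_colourable_mono:
  assumes "edge_colourable k G" and "edges H \<subseteq> edges G" and "k \<le> l"
  shows "edge_colourable l H"
proof -
  obtain c :: "'a set \<Rightarrow> nat" where "c ` edges G \<subseteq> {..<k}" and "proper_edge_colouring G c"
    using assms(1) unfolding edge_colourable_def by blast
  then have "c ` edges H \<subseteq> {..<l}" and "proper_edge_colouring H c"
    using assms(2,3) unfolding proper_edge_colouring_def by (force, blast)
  then show ?thesis
    unfolding edge_colourable_def by blast
qed

text \<open>
  This turns statements about a least number into statements about the existence of a colouring: for
  cubic graphs only the bound \<open>k = 3\<close> matters, and the exact value of a larger index is never computed.
\<close>
lemma chromatic_index_le_iff: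
  assumes "pair_graph G"
  shows "chromatic_index G \<le> k \<longleftrightarrow> edge_colourable k G"
proof
  assume "chromatic_index G \<le> k"
  moreover have "edge_colourable (chromatic_index G) G"
    using chromatic_index_attained[OF assms] unfolding edge_colourable_def .
  ultimately show "edge_colourable k G"
    using edge_colourable_mono by blast
next
  assume "edge_colourable k G"
  then show "chromatic_index G \<le> k"
    unfolding chromatic_index_def edge_colourable_def by (rule Least_le)
qed

section \<open>Disjoint sums\<close>

text \<open>
  The second summand is shifted by \<open>n\<close>; the sum is disjoint because \<open>n\<close> is going to be the number of
  vertices of the first one, whose vertex set is an initial segment. Initial segments are preserved, so
  sums can be iterated, and the increasing enumeration of the vertices lists the summands one after
  the other.
\<close>
definition disjoint_sum :: "nat \<Rightarrow> nat pair_pre_digraph \<Rightarrow> nat pair_pre_digraph \<Rightarrow> nat pair_pre_digraph" where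
  "disjoint_sum n G H =
     \<lparr>pverts = pverts G \<union> (+) n ` pverts H, parcs = parcs G \<union> map_prod ((+) n) ((+) n) ` parcs H\<rparr>"

lemma pverts_disjoint_sum:
  assumes "pverts G = {..<n}" and "pverts H = {..<m}"
  shows "pverts (disjoint_sum n G H) = {..<n + m}"
proof -
  have "(+) n ` {..<m} = {n..<n + m}"
    by (simp add: lessThan_atLeast0 add.commute)
  then show ?thesis
    using assms by (auto simp: disjoint_sum_def)
qed

lemma edges_eq_image: "edges G = (\<lambda>(u, v). {u, v}) ` parcs G"
  by (auto simp: edges_def)

lemma edges_disjoint_sum:
  "edges (disjoint_sum n G H) = edges G \<union> image ((+) n) ` edges H"
  by (simp add: edges_eq_image disjoint_sum_def image_Un image_image case_prod_unfold)

lemma pair_graphI: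
  assumes "finite (pverts G)" and "parcs G \<subseteq> pverts G \<times> pverts G"
    and "sym (parcs G)" and "irrefl (parcs G)"
  shows "pair_graph G"
proof -
  have "finite (parcs G)"
    using assms(1,2) finite_subset by blast
  moreover have "symmetric (with_proj G)"
    using assms(3) by (simp add: symmetric_def)
  ultimately show ?thesis
    using assms by unfold_locales (auto simp: irrefl_def)
qed

lemma pair_graphD:
  assumes "pair_graph G"
  shows "parcs G \<subseteq> pverts G \<times> pverts G" and "sym (parcs G)" and "irrefl (parcs G)"
    and "finite (pverts G)"
proof -
  interpret pair_graph G by fact
  show "parcs G \<subseteq> pverts G \<times> pverts G"
    using in_arcsD1 in_arcsD2 by auto
  show "sym (parcs G)"
    using pair_sym_arcs by (simp add: symmetric_def)
  show "irrefl (parcs G)"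
    using pair_no_loops by (force simp: irrefl_def)
  show "finite (pverts G)"
    by (rule pair_finite_verts)
qed

lemma out_degree_eq_card_neighbours:
  "out_degree (with_proj G) v = card (parcs G `` {v})"
proof -
  have "out_arcs (with_proj G) v = Pair v ` (parcs G `` {v})"
    by (auto simp: out_arcs_def)
  then show ?thesis
    by (simp add: out_degree_def card_image inj_on_def)
qed

lemma cubic_disjoint_sum:
  assumes "cubic_graph G" and "cubic_graph H" and G: "pverts G = {..<n}"
  shows "cubic_graph (disjoint_sum n G H)"
proof -
  let ?S = "disjoint_sum n G H"
  have gr: "pair_graph G" "pair_graph H"
    and deg: "\<And>v. v \<in> pverts G \<Longrightarrow> card (parcs G `` {v}) = 3"
      "\<And>v. v \<in> pverts H \<Longrightarrow> card (parcs H `` {v}) = 3"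
    using assms(1,2) by (auto simp: cubic_graph_def out_degree_eq_card_neighbours)
  note G' = pair_graphD[OF gr(1)] and H' = pair_graphD[OF gr(2)]
  have "pair_graph ?S"
  proof (rule pair_graphI)
    show "finite (pverts ?S)"
      using G'(4) H'(4) by (simp add: disjoint_sum_def)
    show "parcs ?S \<subseteq> pverts ?S \<times> pverts ?S"
      using G'(1) H'(1) by (fastforce simp: disjoint_sum_def)
    show "sym (parcs ?S)"
      using G'(2) H'(2) by (force simp: disjoint_sum_def sym_def)
    show "irrefl (parcs ?S)"
      using G'(3) H'(3) by (auto simp: disjoint_sum_def irrefl_def)
  qed
  moreover have "card (parcs ?S `` {v}) = 3" if "v \<in> pverts ?S" for v
  proof (cases "v < n")
    case True
    then have "parcs ?S `` {v} = parcs G `` {v}"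
      by (auto simp: disjoint_sum_def)
    then show ?thesis
      using True deg(1) G by simp
  next
    case False
    then obtain w where w: "v = n + w" "w \<in> pverts H"
      using \<open>v \<in> pverts ?S\<close> G by (auto simp: disjoint_sum_def)
    then have "parcs ?S `` {v} = (+) n ` (parcs H `` {w})"
      using G G'(1) by (auto simp: disjoint_sum_def image_iff)
    then show ?thesis
      using deg(2)[OF w(2)] by (simp add: card_image)
  qed
  ultimately show ?thesis
    by (simp add: cubic_graph_def out_degree_eq_card_neighbours)
qed

lemma edge_subset_pverts:
  assumes "pair_graph G" and "e \<in> edges G"
  shows "e \<subseteq> pverts G" and "e \<noteq> {}"
  using assms pair_graphD(1) by (fastforce simp: edges_def)+

lemma edge_colourable_disjoint_sum:
  assumes "edge_colourable k G" and "edge_colourable k H"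
    and gr: "pair_graph G" "pair_graph H" and G: "pverts G = {..<n}"
  shows "edge_colourable k (disjoint_sum n G H)"
proof -
  let ?S = "disjoint_sum n G H"
  obtain c d :: "nat set \<Rightarrow> nat"
    where c: "c ` edges G \<subseteq> {..<k}" "proper_edge_colouring G c"
      and d: "d ` edges H \<subseteq> {..<k}" "proper_edge_colouring H d"
    using assms(1,2) unfolding edge_colourable_def by blast
  define b where "b e = (if e \<subseteq> {..<n} then c e else d ((\<lambda>x. x - n) ` e))" for e
  have left: "e \<subseteq> {..<n}" "b e = c e" if "e \<in> edges G" for e
    using edge_subset_pverts[OF gr(1) that] G by (auto simp: b_def)
  have right: "(+) n ` e \<inter> {..<n} = {}" "b ((+) n ` e) = d e" if "e \<in> edges H" for e
  proof -
    show "(+) n ` e \<inter> {..<n} = {}"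
      by auto
    then have "\<not> (+) n ` e \<subseteq> {..<n}"
      using edge_subset_pverts(2)[OF gr(2) that] by blast
    moreover have "(\<lambda>x. x - n) ` (+) n ` e = e"
      by (auto simp: image_iff)
    ultimately show "b ((+) n ` e) = d e"
      by (simp add: b_def)
  qed
  have "b ` edges ?S \<subseteq> {..<k}"
    using c(1) d(1) left right by (auto simp: edges_disjoint_sum)
  moreover have "proper_edge_colouring ?S b"
    unfolding proper_edge_colouring_def edges_disjoint_sum
  proof (intro ballI impI)
    fix e f
    assume e: "e \<in> edges G \<union> image ((+) n) ` edges H"
      and f: "f \<in> edges G \<union> image ((+) n) ` edges H"
      and ef: "e \<noteq> f \<and> e \<inter> f \<noteq> {}"
    consider "e \<in> edges G" "f \<in> edges G"
      | e' f' where "e = (+) n ` e'" "f = (+) n ` f'" "e' \<in> edges H" "f' \<in> edges H"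
      using e f ef left(1) right(1) by blast
    then show "b e \<noteq> b f"
    proof cases
      case 1
      then show ?thesis
        using c(2) ef left by (simp add: proper_edge_colouring_def)
    next
      case 2
      then have "e' \<noteq> f' \<and> e' \<inter> f' \<noteq> {}"
        using ef by (auto simp: image_iff)
      then show ?thesis
        using d(2) 2 right by (simp add: proper_edge_colouring_def)
    qed
  qed
  ultimately show ?thesis
    unfolding edge_colourable_def by blast
qed

section \<open>Characteristic polynomials\<close>

lemma adjacency_matrix_lessThan:
  assumes "pverts G = {..<n}"
  shows "adjacency_matrix G = mat n n (\<lambda>(i, j). if (i, j) \<in> parcs G then 1 else 0)"
proof -
  have "sorted_list_of_set {..<n} = [0..<n]"
    by (simp add: lessThan_atLeast0)
  then show ?thesis
    unfolding adjacency_matrix_def Let_def assms by (auto intro!: eq_matI)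
qed

text \<open>The matrix \<open>x I - M\<close> of a block diagonal \<open>M\<close> is itself block diagonal.\<close>
lemma char_poly_block_diagonal:
  fixes A B :: "'a :: idom mat"
  assumes A: "A \<in> carrier_mat n n" and B: "B \<in> carrier_mat m m"
  shows "char_poly (four_block_mat A (0\<^sub>m n m) (0\<^sub>m m n) B) = char_poly A * char_poly B"
proof -
  have "char_poly_matrix (four_block_mat A (0\<^sub>m n m) (0\<^sub>m m n) B) =
      four_block_mat (char_poly_matrix A) (0\<^sub>m n m) (0\<^sub>m m n) (char_poly_matrix B)"
    using A B by (intro eq_matI) (auto simp: char_poly_matrix_def)
  then show ?thesis
    unfolding char_poly_def
    by (metis det_four_block_mat_upper_right_zero char_poly_matrix_closed A B zero_carrier_mat)
qed

lemma char_poly_disjoint_sum: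
  assumes G: "pair_graph G" "pverts G = {..<n}" and H: "pverts H = {..<m}"
  shows "char_poly (adjacency_matrix (disjoint_sum n G H)) =
    char_poly (adjacency_matrix G) * char_poly (adjacency_matrix H)"
proof -
  have arc_iff: "(i, j) \<in> parcs (disjoint_sum n G H) \<longleftrightarrow>
      (if i < n \<and> j < n then (i, j) \<in> parcs G
       else n \<le> i \<and> n \<le> j \<and> (i - n, j - n) \<in> parcs H)" for i j
  proof -
    have "(i, j) \<in> map_prod ((+) n) ((+) n) ` parcs H \<longleftrightarrow>
        n \<le> i \<and> n \<le> j \<and> (i - n, j - n) \<in> parcs H"
      by (force simp: image_iff)
    then show ?thesis
      using pair_graphD(1)[OF G(1)] G(2) by (auto simp: disjoint_sum_def)
  qed
  have "adjacency_matrix (disjoint_sum n G H) =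
      four_block_mat (adjacency_matrix G) (0\<^sub>m n m) (0\<^sub>m m n) (adjacency_matrix H)"
    unfolding adjacency_matrix_lessThan[OF pverts_disjoint_sum[OF G(2) H]]
      adjacency_matrix_lessThan[OF G(2)] adjacency_matrix_lessThan[OF H]
    by (rule eq_matI) (simp_all add: arc_iff)
  then show ?thesis
    using char_poly_block_diagonal
    by (metis adjacency_matrix_lessThan G(2) H mat_carrier)
qed

text \<open>
  The scalar \<open>c\<close> clears denominators, so that a certificate \<open>P\<close>, \<open>Q\<close> can consist of integers.
\<close>
lemma char_poly_eq_if_intertwined:
  fixes A B :: "'a :: field mat"
  assumes carrier: "A \<in> carrier_mat n n" "B \<in> carrier_mat n n" "P \<in> carrier_mat n n" "Q \<in> carrier_mat n n"
    and AP: "A * P = P * B" and PQ: "P * Q = c \<cdot>\<^sub>m 1\<^sub>m n" and c: "c \<noteq> 0"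
  shows "char_poly A = char_poly B"
proof -
  let ?R = "inverse c \<cdot>\<^sub>m Q"
  have R: "?R \<in> carrier_mat n n"
    using carrier by simp
  have PR: "P * ?R = 1\<^sub>m n"
    using carrier PQ c by (simp add: mult_smult_distrib[of _ n n _ n]) (auto intro!: eq_matI)
  have "?R * P = 1\<^sub>m n"
    by (rule mat_mult_left_right_inverse[OF carrier(3) R PR])
  moreover have "A = P * B * ?R"
    by (metis AP PR R assoc_mult_mat carrier(1,3) right_mult_one_mat)
  ultimately have "similar_mat A B"
    using PR R carrier
    by (intro similar_matI[of _ _ P ?R n]) (simp_all del: assoc_mult_mat mult_smult_assoc_mat)
  then show ?thesis
    by (rule char_poly_similar)
qed

section \<open>Graphs given by edge lists\<close>

definition edge_graph :: "nat \<Rightarrow> (nat \<times> nat) list \<Rightarrow> nat pair_pre_digraph" where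
  "edge_graph n es = \<lparr>pverts = {..<n}, parcs = set es \<union> (set es)\<inverse>\<rparr>"

lemma edges_edge_graph: "edges (edge_graph n es) = (\<lambda>(u, v). {u, v}) ` set es"
  by (force simp: edges_eq_image edge_graph_def insert_commute)

lemma cubic_edge_graph:
  assumes "\<forall>(u, v) \<in> set es. u < v \<and> v < n"
    and deg: "\<forall>v \<in> set [0..<n]. length (filter (\<lambda>w. (v, w) \<in> set es \<or> (w, v) \<in> set es) [0..<n]) = 3"
  shows "cubic_graph (edge_graph n es)"
proof -
  let ?G = "edge_graph n es"
  have "pair_graph ?G"
    using assms(1) by (intro pair_graphI) (auto simp: edge_graph_def sym_def irrefl_def)
  moreover have "card (parcs ?G `` {v}) = 3" if "v < n" for v
  proof -
    have "parcs ?G `` {v} = set (filter (\<lambda>w. (v, w) \<in> set es \<or> (w, v) \<in> set es) [0..<n])"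
      using assms(1) that by (auto simp: edge_graph_def)
    also have "card \<dots> = 3"
      unfolding distinct_card[OF distinct_filter[OF distinct_upt]]
      using deg that by simp
    finally show ?thesis .
  qed
  ultimately show ?thesis
    by (simp add: cubic_graph_def out_degree_eq_card_neighbours edge_graph_def)
qed

text \<open>
  A proper colouring is a partition into matchings, one for each colour. That a list of edges is a
  matching is expressed by distinctness of all its end points, which the simplifier decides.
\<close>
lemma edge_colourable_if_matchings:
  assumes "\<forall>M \<in> set Ms. distinct (concat (map (\<lambda>(u, v). [u, v]) M))"
  shows "edge_colourable (length Ms) (edge_graph n (concat Ms))"
proof -
  have matching: "{u, v} = {u', v'}"
    if "distinct (concat (map (\<lambda>(u, v). [u, v]) M))" and "(u, v) \<in> set M" and "(u', v') \<in> set M"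
      and "{u, v} \<inter> {u', v'} \<noteq> {}" for M :: "(nat \<times> nat) list" and u v u' v'
    using that by (induction M) fastforce+
  let ?is = "\<lambda>e i. i < length Ms \<and> e \<in> (\<lambda>(u, v). {u, v}) ` set (Ms ! i)"
  (* Any choice will do: whichever matching an edge is assigned to, it meets no other edge there. *)
  define c where "c e = (SOME i. ?is e i)" for e
  have c: "?is e (c e)" if "e \<in> edges (edge_graph n (concat Ms))" for e
  proof -
    have "\<exists>i. ?is e i"
      using that by (fastforce simp: edges_edge_graph in_set_conv_nth[of _ Ms])
    then show ?thesis
      unfolding c_def by (rule someI_ex)
  qed
  have "proper_edge_colouring (edge_graph n (concat Ms)) c"
    unfolding proper_edge_colouring_def
  proof (intro ballI impI notI)
    fix e f
    assume e: "e \<in> edges (edge_graph n (concat Ms))" and f: "f \<in> edges (edge_graph n (concat Ms))"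
      and ef: "e \<noteq> f \<and> e \<inter> f \<noteq> {}" and eq: "c e = c f"
    obtain u v where uv: "e = {u, v}" "(u, v) \<in> set (Ms ! c e)"
      using c[OF e] by auto
    obtain u' v' where uv': "f = {u', v'}" "(u', v') \<in> set (Ms ! c e)"
      using c[OF f] eq by auto
    have "Ms ! c e \<in> set Ms"
      using c[OF e] by simp
    from matching[OF bspec[OF assms this] uv(2) uv'(2)] show False
      using ef uv(1) uv'(1) by simp
  qed
  then show ?thesis
    unfolding edge_colourable_def using c by blast
qed

text \<open>
  Backtracking search: can the coloured edges \<open>cs\<close> be extended to the remaining edges with the colours
  0, 1, 2? The conditional, in place of a conjunction, makes the simplifier cut off a branch as soon as a
  conflict appears, because it does not rewrite the arms before the condition is decided.
\<close>
fun extensible :: "(nat \<times> nat) list \<Rightarrow> ((nat \<times> nat) \<times> nat) list \<Rightarrow> bool" where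
  "extensible [] cs \<longleftrightarrow> True"
| "extensible ((u, v) # es) cs \<longleftrightarrow>
     list_ex (\<lambda>k. if list_ex (\<lambda>((x, y), l). l = k \<and> (x = u \<or> x = v \<or> y = u \<or> y = v)) cs
                  then False else extensible es (((u, v), k) # cs)) [0, 1, 2]"

text \<open>
  An actual colouring \<open>c\<close> is never cut off by the search: the branch that follows \<open>c\<close> survives, whatever
  edges \<open>ds\<close> have been treated before. The orientation \<open>u < v\<close> ensures that distinct pairs are distinct
  edges, so that a conflict found by the search is a conflict between two different edges.
\<close>
lemma extensible_if_proper:
  assumes c: "c ` edges G \<subseteq> {..<3}" "proper_edge_colouring G c"
    and "(\<lambda>(u, v). {u, v}) ` (set es \<union> set ds) \<subseteq> edges G"
    and "distinct (es @ ds)" and "\<forall>(u, v) \<in> set es \<union> set ds. u < v"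
  shows "extensible es (map (\<lambda>(u, v). ((u, v), c {u, v})) ds)"
  using assms(3-5)
proof (induction es arbitrary: ds)
  case Nil
  then show ?case by simp
next
  case (Cons e es)
  obtain u v where e: "e = (u, v)"
    by (cases e)
  let ?cs = "map (\<lambda>(u, v). ((u, v), c {u, v}))"
  have rest: "extensible es (?cs ((u, v) # ds))"
    using Cons.prems e by (intro Cons.IH) auto
  have uv: "{u, v} \<in> edges G"
    using Cons.prems(1) e by auto
  have "c {u, v} < 3"
    using uv c(1) by auto
  then have k: "c {u, v} \<in> set [0, 1, 2]"
    by auto
  have "c {x, y} \<noteq> c {u, v}" if "(x, y) \<in> set ds" and "x = u \<or> x = v \<or> y = u \<or> y = v" for x y
  proof -
    have "{x, y} \<in> edges G"
      using Cons.prems(1) that(1) by auto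
    moreover have "{x, y} \<noteq> {u, v}"
    proof -
      have "x < y" and "u < v" and "(x, y) \<noteq> (u, v)"
        using Cons.prems(2,3) that(1) e by auto
      then show ?thesis
        by (auto simp: doubleton_eq_iff)
    qed
    moreover have "{x, y} \<inter> {u, v} \<noteq> {}"
      using that(2) by auto
    ultimately show ?thesis
      using c(2)[unfolded proper_edge_colouring_def, rule_format, of "{x, y}" "{u, v}"] uv by simp
  qed
  then have "\<not> list_ex (\<lambda>((x, y), l). l = c {u, v} \<and> (x = u \<or> x = v \<or> y = u \<or> y = v)) (?cs ds)"
    unfolding list_ex_iff by fastforce
  then have "if list_ex (\<lambda>((x, y), l). l = c {u, v} \<and> (x = u \<or> x = v \<or> y = u \<or> y = v)) (?cs ds)
      then False else extensible es (((u, v), c {u, v}) # ?cs ds)"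
    using rest by simp
  then show ?case
    using k unfolding e extensible.simps list_ex_iff by (rule bexI)
qed

lemma not_edge_colourable_if_not_extensible:
  assumes "\<not> extensible es []" and "distinct es" and "\<forall>(u, v) \<in> set es. u < v"
  shows "\<not> edge_colourable 3 (edge_graph n es)"
  unfolding edge_colourable_def
  using extensible_if_proper[of _ "edge_graph n es" es "[]"] assms by (auto simp: edges_edge_graph)

section \<open>Integer certificates for similarity\<close>

text \<open>
  Matrices are lists of rows here, and a row of a product is a linear combination of rows of the
  second factor. The simplifier evaluates this by running along lists, without any indexing.
\<close>
fun row_combination :: "nat \<Rightarrow> int list \<Rightarrow> int list list \<Rightarrow> int list" where
  "row_combination n (a # as) (r # rs) = map2 (\<lambda>x y. a * x + y) r (row_combination n as rs)"
| "row_combination n as rs = replicate n 0"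

lemma row_combination_nth:
  assumes "length as = length rs" and "\<forall>r \<in> set rs. length r = n"
  shows "length (row_combination n as rs) = n"
    and "j < n \<Longrightarrow> row_combination n as rs ! j = (\<Sum>k < length rs. as ! k * rs ! k ! j)"
proof -
  have "length (row_combination n as rs) = n \<and>
      (j < n \<longrightarrow> row_combination n as rs ! j = (\<Sum>k < length rs. as ! k * rs ! k ! j))"
    using assms
    by (induction as rs rule: list_induct2) (auto simp: sum.lessThan_Suc_shift simp del: sum.lessThan_Suc)
  then show "length (row_combination n as rs) = n"
    and "j < n \<Longrightarrow> row_combination n as rs ! j = (\<Sum>k < length rs. as ! k * rs ! k ! j)"
    by auto
qed

definition rows_mult :: "int list list \<Rightarrow> int list list \<Rightarrow> int list list" where
  "rows_mult X Y = map (\<lambda>r. row_combination (length X) r Y) X"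

definition square_rows :: "nat \<Rightarrow> 'a list list \<Rightarrow> bool" where
  "square_rows n X \<longleftrightarrow> length X = n \<and> (\<forall>r \<in> set X. length r = n)"

abbreviation complex_mat :: "int list list \<Rightarrow> complex mat" where
  "complex_mat X \<equiv> map_mat of_int (mat_of_rows_list (length X) X)"

lemma complex_mat_rows_mult:
  assumes X: "square_rows n X" and Y: "square_rows n Y"
  shows "complex_mat (rows_mult X Y) = complex_mat X * complex_mat Y"
proof -
  have "mat_of_rows_list n (rows_mult X Y) = mat_of_rows_list n X * mat_of_rows_list n Y"
  proof (rule eq_matI)
    fix i j
    assume "i < dim_row (mat_of_rows_list n X * mat_of_rows_list n Y)"
      and "j < dim_col (mat_of_rows_list n X * mat_of_rows_list n Y)"
    then have ij: "i < n" "j < n"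
      using X by (auto simp: mat_of_rows_list_def square_rows_def)
    have "X ! i \<in> set X"
      using ij X by (simp add: square_rows_def)
    then have "length (X ! i) = length Y" and "\<forall>r \<in> set Y. length r = n"
      using X Y by (auto simp: square_rows_def)
    from row_combination_nth(2)[OF this ij(2), of] ij X Y
    show "mat_of_rows_list n (rows_mult X Y) $$ (i, j) =
        (mat_of_rows_list n X * mat_of_rows_list n Y) $$ (i, j)"
      by (simp add: mat_of_rows_list_def rows_mult_def scalar_prod_def square_rows_def lessThan_atLeast0)
  qed (use X in \<open>auto simp: mat_of_rows_list_def rows_mult_def square_rows_def\<close>)
  moreover have "mat_of_rows_list n X \<in> carrier_mat n n" "mat_of_rows_list n Y \<in> carrier_mat n n"
    using X Y by (auto simp: mat_of_rows_list_def square_rows_def)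
  ultimately show ?thesis
    using X Y of_int_hom.mat_hom_mult[where ?'a = complex]
    by (simp add: square_rows_def rows_mult_def)
qed

definition adjacency_rows :: "nat \<Rightarrow> (nat \<times> nat) list \<Rightarrow> int list list" where
  "adjacency_rows n es =
     map (\<lambda>i. map (\<lambda>j. if (i, j) \<in> set es \<or> (j, i) \<in> set es then 1 else 0) [0..<n]) [0..<n]"

definition scalar_rows :: "nat \<Rightarrow> int \<Rightarrow> int list list" where
  "scalar_rows n c = map (\<lambda>i. map (\<lambda>j. if i = j then c else 0) [0..<n]) [0..<n]"

lemma adjacency_matrix_edge_graph:
  "adjacency_matrix (edge_graph n es) = complex_mat (adjacency_rows n es)"
proof -
  have "pverts (edge_graph n es) = {..<n}"
    by (simp add: edge_graph_def)
  from adjacency_matrix_lessThan[OF this] show ?thesis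
    by (intro eq_matI) (auto simp: adjacency_rows_def mat_of_rows_list_def edge_graph_def)
qed

text \<open>The hypotheses \<open>AP\<close> and \<open>PQ\<close> are closed equations between lists of integers for concrete data.\<close>
lemma char_poly_eq_if_intertwined_rows:
  assumes P: "square_rows n P" and Q: "square_rows n Q"
    and AP: "rows_mult (adjacency_rows n es) P = rows_mult P (adjacency_rows n fs)"
    and PQ: "rows_mult P Q = scalar_rows n c" and c: "c \<noteq> 0"
  shows "char_poly (adjacency_matrix (edge_graph n es)) = char_poly (adjacency_matrix (edge_graph n fs))"
  unfolding adjacency_matrix_edge_graph
proof (rule char_poly_eq_if_intertwined)
  have adj: "square_rows n (adjacency_rows n es)" for es
    by (auto simp: square_rows_def adjacency_rows_def)
  have carrier: "complex_mat X \<in> carrier_mat n n" if "square_rows n X" for X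
    using that by (auto simp: square_rows_def mat_of_rows_list_def)
  show "complex_mat (adjacency_rows n es) \<in> carrier_mat n n"
    "complex_mat (adjacency_rows n fs) \<in> carrier_mat n n"
    "complex_mat P \<in> carrier_mat n n" "complex_mat Q \<in> carrier_mat n n"
    by (rule carrier[OF adj] carrier[OF P] carrier[OF Q])+
  show "complex_mat (adjacency_rows n es) * complex_mat P = complex_mat P * complex_mat (adjacency_rows n fs)"
    using AP by (metis complex_mat_rows_mult adj P)
  have "complex_mat (scalar_rows n c) = of_int c \<cdot>\<^sub>m 1\<^sub>m n"
    by (intro eq_matI) (auto simp: scalar_rows_def mat_of_rows_list_def)
  then show "complex_mat P * complex_mat Q = of_int c \<cdot>\<^sub>m 1\<^sub>m n"
    using PQ by (metis complex_mat_rows_mult P Q)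
  show "complex_of_int c \<noteq> 0"
    using c by simp
qed

section \<open>A pair on 16 vertices\<close>

text \<open>
  The first two matchings alternate along the Hamiltonian cycle 0, 1, ..., 15; the third consists of
  the chords.
\<close>
definition tait_matchings :: "(nat \<times> nat) list list" where
  "tait_matchings =
    [[(0, 1), (2, 3), (4, 5), (6, 7), (8, 9), (10, 11), (12, 13), (14, 15)],
     [(1, 2), (3, 4), (5, 6), (7, 8), (9, 10), (11, 12), (13, 14), (0, 15)],
     [(0, 9), (1, 12), (2, 4), (3, 10), (5, 14), (6, 8), (7, 11), (13, 15)]]"

definition tait_graph :: "nat pair_pre_digraph" where
  "tait_graph = edge_graph 16 (concat tait_matchings)"

text \<open>
  In the Petersen graph, 0, ..., 4 is the outer cycle, 5, ..., 9 are the inner vertices, and \<open>i\<close> is joined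
  to \<open>i + 5\<close>. The vertices 0, 1, 2 are replaced by the triangles \<open>{0, 10, 11}\<close>, \<open>{1, 12, 13}\<close> and
  \<open>{2, 14, 15}\<close>. The edges are ordered such that early ones share many end points, which keeps the
  search for a colouring short.
\<close>
definition truncated_petersen_edges :: "(nat \<times> nat) list" where
  "truncated_petersen_edges =
    [(0, 4), (0, 10), (0, 11), (10, 11), (5, 10), (11, 12), (1, 12), (12, 13), (1, 13), (13, 14),
     (1, 6), (3, 4), (4, 9), (6, 9), (6, 8), (3, 8), (5, 8), (5, 7), (7, 9), (2, 3), (7, 15),
     (2, 14), (2, 15), (14, 15)]"

definition truncated_petersen :: "nat pair_pre_digraph" where
  "truncated_petersen = edge_graph 16 truncated_petersen_edges"

definition K4_matchings :: "(nat \<times> nat) list list" where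
  "K4_matchings = [[(0, 1), (2, 3)], [(0, 2), (1, 3)], [(0, 3), (1, 2)]]"

definition K4 :: "nat pair_pre_digraph" where
  "K4 = edge_graph 4 (concat K4_matchings)"

lemma cubic_graphs: "cubic_graph tait_graph" "cubic_graph truncated_petersen" "cubic_graph K4"
  unfolding tait_graph_def truncated_petersen_def K4_def
  by (rule cubic_edge_graph; simp add: tait_matchings_def truncated_petersen_edges_def K4_matchings_def upt_rec)+

lemma tait_graph_colourable: "edge_colourable 3 tait_graph"
proof -
  have "edge_colourable (length tait_matchings) tait_graph"
    unfolding tait_graph_def by (rule edge_colourable_if_matchings) (simp add: tait_matchings_def)
  then show ?thesis
    by (simp add: tait_matchings_def eval_nat_numeral)
qed

lemma K4_colourable: "edge_colourable 3 K4"
proof -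
  have "edge_colourable (length K4_matchings) K4"
    unfolding K4_def by (rule edge_colourable_if_matchings) (simp add: K4_matchings_def)
  then show ?thesis
    by (simp add: K4_matchings_def eval_nat_numeral)
qed

lemma truncated_petersen_not_colourable: "\<not> edge_colourable 3 truncated_petersen"
  unfolding truncated_petersen_def
proof (rule not_edge_colourable_if_not_extensible)
  show "\<not> extensible truncated_petersen_edges []"
    unfolding truncated_petersen_edges_def by simp
qed (simp_all add: truncated_petersen_edges_def)

text \<open>
  The integer solutions \<open>X\<close> of \<open>A X = X B\<close> form a lattice, of rank 16 for this pair; the matrix below is an
  invertible element with small entries, found by lattice reduction. Each of its rows has sum 1:
  it fixes the all-ones vector, the eigenvector of \<open>A\<close> and of \<open>B\<close> for the eigenvalue 3.
\<close>
definition intertwiner :: "int list list" where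
  "intertwiner =
    [[ 0,  0,  0,  0, -1,  1,  0,  0,  0,  0,  0, -1,  0,  0,  1,  1],
     [-1,  0,  1,  0,  0,  0,  0,  0,  1, -1,  0,  0,  0,  0,  1,  0],
     [ 0,  0,  0,  1, -1,  0,  0,  0,  0,  0,  0,  0,  0,  1,  0,  0],
     [ 0,  0,  0, -1,  1,  0,  0,  0,  0,  0,  0,  0,  1,  0,  0,  0],
     [ 0,  1,  0,  0,  0,  0,  0,  0,  0,  0,  0,  0,  0,  0,  0,  0],
     [ 0,  0,  0,  0,  0,  0,  1,  0,  0,  0,  0,  0,  0,  0,  0,  0],
     [ 1,  0, -1,  0,  0,  0,  0,  0,  1,  0,  1,  1,  0,  0, -1, -1],
     [ 1,  0, -1,  0,  1,  1,  0, -1,  0,  0,  1,  1,  0,  0, -1, -1],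
     [ 1,  0, -1,  0,  0,  1,  0,  0,  0,  0,  1,  1,  1, -1, -1, -1],
     [ 0,  0,  0, -1,  0,  0,  0,  1,  0,  0,  1,  1,  0,  0, -1,  0],
     [ 1,  0, -1,  0,  0,  0,  0,  0, -1,  1,  0,  1,  0,  0,  0,  0],
     [ 1,  0,  0,  0,  1, -1,  0,  0,  0,  0,  1,  0,  0,  0,  0, -1],
     [ 0,  0,  1,  1,  0,  0,  0, -1,  0,  0, -1,  0,  0,  0,  0,  1],
     [-1,  0,  1,  1,  0, -1,  0,  1,  0,  0, -1, -1,  0,  0,  1,  1],
     [-1,  0,  1,  0,  0,  0,  0,  0,  0,  1, -1, -1,  0,  0,  1,  1],
     [-1,  0,  1,  0,  0,  0,  0,  1,  0,  0, -1, -1, -1,  1,  1,  1]]"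

text \<open>The inverse, scaled by the common denominator 87 of its entries.\<close>
definition intertwiner_inverse :: "int list list" where
  "intertwiner_inverse =
    [[ 17, -12, -13,  13,   0,   0,  24, -50,  37, -17,  12,  41,  46, -37, -24,  50],
     [  0,   0,   0,   0,  87,   0,   0,   0,   0,   0,   0,   0,   0,   0,   0,   0],
     [-17,  12,  13, -13,   0,   0, -24, -37,  50,  17, -12,  46,  41, -50,  24,  37],
     [  1,   1,  18, -18,   0,   0,  -2,  38,   9,  -1,  -1,  -1,   1,  49,   2,  -9],
     [ -1,  -1, -18,  18,   0,   0,   2,  49,  -9,   1,   1,   1,  -1,  38,  -2,   9],
     [  5,   5,   3,  -3,   0,   0, -10,  16,  45,  -5,  -5,  -5,   5, -16,  10,  42],
     [  0,   0,   0,   0,   0,  87,   0,   0,   0,   0,   0,   0,   0,   0,   0,   0],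
     [ -5,  -5,  -3,   3,   0,   0,  10, -16,  42,   5,   5,   5,  -5,  16, -10,  45],
     [  9,   9, -12,  12,   0,   0,  69,  -6,  -6,  -9,  -9,  -9,   9,   6,  18,   6],
     [ -9,  -9,  12, -12,   0,   0,  18,   6,   6,   9,   9,   9,  -9,  -6,  69,  -6],
     [ 38,   9,  17, -17,   0,   0, -18,  52, -35,  49,  -9,  20, -20,  35,  18, -52],
     [-16,  42,   2,  -2,   0,   0,   3,   1,   1,  16,  45, -13,  13,  -1,  -3,  -1],
     [  2,   2,  36,  51,   0,   0,  -4, -11,  18,  -2,  -2,  -2,   2,  11,   4, -18],
     [ -2,  -2,  51,  36,   0,   0,   4,  11, -18,   2,   2,   2,  -2, -11,  -4,  18],
     [ 16,  45,  -2,   2,   0,   0,  -3,  -1,  -1, -16,  42,  13, -13,   1,   3,   1],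
     [ 49,  -9, -17,  17,   0,   0,  18,  35, -52,  38,   9, -20,  20,  52, -18, -35]]"

lemma char_poly_tait_graph_eq_truncated_petersen:
  "char_poly (adjacency_matrix tait_graph) = char_poly (adjacency_matrix truncated_petersen)"
  unfolding tait_graph_def truncated_petersen_def
proof (rule char_poly_eq_if_intertwined_rows)
  have upt: "[0..<16] = [0, 1, 2, 3, 4, 5, 6, 7, 8, 9, 10, 11, 12, 13, 14, 15 :: nat]"
    by (simp add: upt_rec)
  show "square_rows 16 intertwiner" "square_rows 16 intertwiner_inverse"
    by (simp_all add: square_rows_def intertwiner_def intertwiner_inverse_def)
  show "rows_mult (adjacency_rows 16 (concat tait_matchings)) intertwiner =
      rows_mult intertwiner (adjacency_rows 16 truncated_petersen_edges)"
    by (simp add: rows_mult_def adjacency_rows_def upt tait_matchings_def truncated_petersen_edges_def intertwiner_def)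
  show "rows_mult intertwiner intertwiner_inverse = scalar_rows 16 87"
    by (simp add: rows_mult_def scalar_rows_def upt intertwiner_def intertwiner_inverse_def)
qed simp

section \<open>Adding copies of the complete graph on four vertices\<close>

fun add_K4s :: "nat \<Rightarrow> nat pair_pre_digraph \<Rightarrow> nat \<Rightarrow> nat pair_pre_digraph" where
  "add_K4s n G 0 = G"
| "add_K4s n G (Suc k) = disjoint_sum (n + 4 * k) (add_K4s n G k) K4"

lemma pverts_K4: "pverts K4 = {..<4}"
  by (simp add: K4_def edge_graph_def)

lemma pverts_add_K4s:
  assumes "pverts G = {..<n}"
  shows "pverts (add_K4s n G k) = {..<n + 4 * k}"
proof (induction k)
  case (Suc k)
  show ?case
    using pverts_disjoint_sum[OF Suc pverts_K4] by (simp add: algebra_simps)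
qed (simp add: assms)

lemma cubic_add_K4s:
  assumes "cubic_graph G" and "pverts G = {..<n}"
  shows "cubic_graph (add_K4s n G k)"
proof (induction k)
  case (Suc k)
  show ?case
    using cubic_disjoint_sum[OF Suc cubic_graphs(3) pverts_add_K4s[OF assms(2)]] by simp
qed (simp add: assms)

lemma pair_graph_if_cubic: "cubic_graph G \<Longrightarrow> pair_graph G"
  by (simp add: cubic_graph_def)

lemma edge_colourable_add_K4s_iff:
  assumes G: "cubic_graph G" "pverts G = {..<n}"
  shows "edge_colourable 3 (add_K4s n G k) \<longleftrightarrow> edge_colourable 3 G"
proof (induction k)
  case (Suc k)
  note graphs = cubic_add_K4s[OF G, THEN pair_graph_if_cubic] cubic_graphs(3)[THEN pair_graph_if_cubic]
  have "edges (add_K4s n G k) \<subseteq> edges (add_K4s n G (Suc k))"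
    by (simp add: edges_disjoint_sum)
  then show ?case
    using Suc edge_colourable_mono[of 3 _ _ 3]
      edge_colourable_disjoint_sum[OF _ K4_colourable graphs pverts_add_K4s[OF G(2)]]
    by (metis add_K4s.simps(2) order_refl)
qed simp

lemma char_poly_add_K4s_cong:
  assumes G: "cubic_graph G" "pverts G = {..<n}" and H: "cubic_graph H" "pverts H = {..<n}"
    and "char_poly (adjacency_matrix G) = char_poly (adjacency_matrix H)"
  shows "char_poly (adjacency_matrix (add_K4s n G k)) = char_poly (adjacency_matrix (add_K4s n H k))"
proof (induction k)
  case (Suc k)
  have step: "char_poly (adjacency_matrix (add_K4s n F (Suc k))) =
      char_poly (adjacency_matrix (add_K4s n F k)) * char_poly (adjacency_matrix K4)"
    if "cubic_graph F" "pverts F = {..<n}" for F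
    using char_poly_disjoint_sum[OF pair_graph_if_cubic[OF cubic_add_K4s[OF that]]
        pverts_add_K4s[OF that(2)] pverts_K4] by simp
  show ?case
    unfolding step[OF G] step[OF H] Suc ..
qed (simp add: assms)

lemma card_verts_digraph_iso:
  assumes "digraph_iso G H"
  shows "card (verts H) = card (verts G)"
proof -
  obtain f where f: "pre_digraph.digraph_isomorphism G f" and H: "H = app_iso f G"
    using assms unfolding digraph_iso_def by blast
  have "inj_on (iso_verts f) (verts G)"
    using f by (rule pre_digraph.digraph_isomorphism_inj_on_verts)
  then show ?thesis
    unfolding H by (simp add: app_iso_def card_image)
qed

theorem theorem2:
  shows "infinite ({(G :: nat pair_pre_digraph, G' :: nat pair_pre_digraph).
            cubic_graph G \<and> cubic_graph G' \<and> cospectral G G' \<and>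
            chromatic_index G \<noteq> chromatic_index G'} // pair_iso)"
    (is "infinite (?S // pair_iso)")
proof -
  define p where "p k = (add_K4s 16 tait_graph k, add_K4s 16 truncated_petersen k)" for k
  have pverts: "pverts tait_graph = {..<16}" "pverts truncated_petersen = {..<16}"
    by (simp_all add: tait_graph_def truncated_petersen_def edge_graph_def)
  have p: "p k \<in> ?S" for k
  proof -
    have cubic: "cubic_graph (add_K4s 16 tait_graph k)" "cubic_graph (add_K4s 16 truncated_petersen k)"
      using cubic_add_K4s cubic_graphs pverts by blast+
    moreover have "cospectral (add_K4s 16 tait_graph k) (add_K4s 16 truncated_petersen k)"
      using char_poly_add_K4s_cong[OF cubic_graphs(1) pverts(1) cubic_graphs(2) pverts(2)
          char_poly_tait_graph_eq_truncated_petersen]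
      by (simp add: cospectral_def graph_spectrum_def)
    moreover have "chromatic_index (add_K4s 16 tait_graph k) \<le> 3"
      using edge_colourable_add_K4s_iff[OF cubic_graphs(1) pverts(1)] tait_graph_colourable
      by (simp add: chromatic_index_le_iff pair_graph_if_cubic cubic)
    moreover have "\<not> chromatic_index (add_K4s 16 truncated_petersen k) \<le> 3"
      using edge_colourable_add_K4s_iff[OF cubic_graphs(2) pverts(2)] truncated_petersen_not_colourable
      by (simp add: chromatic_index_le_iff pair_graph_if_cubic cubic)
    ultimately show ?thesis
      unfolding p_def by auto
  qed
  have "inj (\<lambda>k. pair_iso `` {p k})"
  proof (rule injI)
    fix j k
    (* Equal classes only help because p k lies in its own class, which needs reflexivity. *)
    assume eq: "pair_iso `` {p j} = pair_iso `` {p k}"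
    define A :: "(nat pair_pre_digraph \<times> nat pair_pre_digraph) set"
      where "A = {(G, G'). pair_graph G \<and> pair_graph G'}"
    have "p k \<in> A"
      using p[of k] by (auto simp: A_def p_def intro: pair_graph_if_cubic)
    moreover have "refl_on A (pair_iso \<inter> A \<times> A)"
      using equiv_pair_iso[OF A_def] by (rule equivE)
    ultimately have "(p k, p k) \<in> pair_iso \<inter> A \<times> A"
      by (rule refl_onD[rotated])
    then have "(p k, p k) \<in> pair_iso"
      by (rule IntD1)
    then have "(p j, p k) \<in> pair_iso"
      using eq by blast
    then have "digraph_iso (with_proj (add_K4s 16 tait_graph j)) (with_proj (add_K4s 16 tait_graph k))"
      by (simp add: pair_iso_def p_def)
    from card_verts_digraph_iso[OF this] show "j = k"
      by (simp add: pverts_add_K4s[OF pverts(1)])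
  qed
  then have "infinite (range (\<lambda>k. pair_iso `` {p k}))"
    by (rule range_inj_infinite)
  moreover have "range (\<lambda>k. pair_iso `` {p k}) \<subseteq> ?S // pair_iso"
    by (intro image_subsetI quotientI p)
  ultimately show ?thesis
    using finite_subset by blast
qed

end
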